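(* For every integer $n\ge 1$, let $L_n$ be the set of positive Dyck numbers whose binary expansion has length exactly $n$. Then $$\#L_n=\binom{n-1}{\lfloor (n-1)/2\rfloor}.$$
   Context: A positive integer $d$ is a (positive) Dyck number if, in its binary expansion (written without leading zeros), every suffix contains at least as many digits 1 as digits 0. (These are the positive terms of OEIS A036991: $1,3,5,7,11,13,15,19,\dots$.) For instance $L_1=\{1\}$, $L_2=\{3\}$, $L_3=\{5,7\}$. The binomial coefficients $\binom{m}{\lfloor m/2\rfloor}$, $m\ge 0$, are the terms $A001405(m)$ of OEIS A001405. *)

theory Defs
  imports Main "HOL-Library.Sublist"
begin

(* Most significant digit first; 0 has the empty expansion. *)
function binary_digits :: "nat \<Rightarrow> nat list" where
  "binary_digits n = (if n = 0 then [] else binary_digits (n div 2) @ [n mod 2])"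
  by auto
termination by (relation "measure id") auto

declare binary_digits.simps [simp del]

lemma binary_digits_0 [simp]: "binary_digits 0 = []"
  by (simp add: binary_digits.simps)

(* These three facts characterise the binary expansion without leading zeros. *)
lemma binary_digits_value:
  "horner_sum id 2 (rev (binary_digits n)) = n"
proof (induction n rule: binary_digits.induct)
  case (1 n)
  then show ?case
    by (cases "n = 0") (simp_all add: binary_digits.simps [of n])
qed

lemma set_binary_digits: "set (binary_digits n) \<subseteq> {0, 1}"
proof (induction n rule: binary_digits.induct)
  case (1 n)
  then show ?case
    by (cases "n = 0") (auto simp: binary_digits.simps [of n])
qed

lemma hd_binary_digits: "n > 0 \<Longrightarrow> binary_digits n \<noteq> [] \<and> hd (binary_digits n) = 1"
proof (induction n rule: binary_digits.induct)
  case (1 n)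
  show ?case
  proof (cases "n = 1")
    case True
    then show ?thesis
      by (simp add: binary_digits.simps)
  next
    case False
    with 1 have "n div 2 > 0" "n \<noteq> 0"
      by auto
    with 1 show ?thesis
      by (simp add: binary_digits.simps [of n])
  qed
qed

definition dyck_number :: "nat \<Rightarrow> bool" where
  "dyck_number d \<longleftrightarrow>
     d > 0 \<and> (\<forall>s. suffix s (binary_digits d) \<longrightarrow> count_list s 0 \<le> count_list s 1)"

definition dyck_numbers_of_length :: "nat \<Rightarrow> nat set" where
  "dyck_numbers_of_length n = {d. dyck_number d \<and> length (binary_digits d) = n}"

end

(* Deleting the leading 1 identifies the Dyck numbers of length m + 1 with the words of length m
   all of whose suffixes have at least as many 1s as 0s.  For 2 j \<le> m, exactly m choose j of these
   words have at most j zeros: splitting off the first letter yields Pascal's rule, and in the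
   boundary case 2 j = m + 1 the symmetry of the binomial coefficients takes over.  Every such word
   of length m has at most m div 2 zeros, so j = m div 2 counts them all. *)
theory Submission
  imports Defs
begin

lemma binary_digits_double:
  assumes "v > 0" "x < 2"
  shows "binary_digits (x + 2 * v) = binary_digits v @ [x]"
  using assms by (simp add: binary_digits.simps [of "x + 2 * v"])

text \<open>Supplies preimages under \<open>binary_digits\<close>. The induction appends the least
  significant digit, turning the value v into x + 2 * v; positivity is carried along because
  \<open>binary_digits_double\<close> needs it.\<close>

lemma binary_digits_horner_sum:
  assumes "set t \<subseteq> {0, 1}"
  shows "horner_sum id 2 (rev (1 # t)) > (0::nat) \<and>
    binary_digits (horner_sum id 2 (rev (1 # t))) = 1 # t"
  using assms
proof (induction t rule: rev_induct)
  case Nil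
  then show ?case by (simp add: binary_digits.simps)
next
  case (snoc x t)
  then have "x < 2" by auto
  with snoc show ?case
    using binary_digits_double [of "horner_sum id 2 (rev (1 # t))" x]
    by (auto simp: id_def)
qed

lemma inj_binary_digits: "inj binary_digits"
  by (metis injI binary_digits_value)

text \<open>Read from right to left, with 1 as an up-step and 0 as a down-step, these are the
  lattice paths that never go below their starting height.\<close>

definition ballot :: "nat list \<Rightarrow> bool" where
  "ballot t \<longleftrightarrow> set t \<subseteq> {0, 1} \<and> (\<forall>s. suffix s t \<longrightarrow> count_list s 0 \<le> count_list s 1)"

lemma ballot_Nil: "ballot []"
  by (simp add: ballot_def)

text \<open>Prepending a letter creates just one new suffix, the whole word. A 1 cannot violate its
  inequality, whereas a 0 requires a strict surplus of ones in the tail.\<close>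

lemma ballot_one: "ballot (1 # t) \<longleftrightarrow> ballot t"
  by (auto simp: ballot_def suffix_Cons le_SucI)

lemma ballot_zero: "ballot (0 # t) \<longleftrightarrow> ballot t \<and> count_list t 0 < count_list t 1"
  by (auto simp: ballot_def suffix_Cons)

lemma ballot_hd: "ballot (x # t) \<Longrightarrow> x = 0 \<or> x = 1"
  by (auto simp: ballot_def)

lemma ballot_count_le: "ballot t \<Longrightarrow> count_list t 0 \<le> count_list t 1"
  by (simp add: ballot_def)

lemma count_list_zero_one:
  "set t \<subseteq> {0, 1::nat} \<Longrightarrow> count_list t 0 + count_list t 1 = length t"
  by (induction t) auto

lemma ballot_length: "ballot t \<Longrightarrow> count_list t 0 + count_list t 1 = length t"
  using count_list_zero_one [of t] by (simp add: ballot_def)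

text \<open>Bounding the number of zeros, instead of fixing it, makes the count a single binomial
  coefficient; with exactly j zeros it would be a difference of two.\<close>

definition ballots :: "nat \<Rightarrow> nat \<Rightarrow> nat list set" where
  "ballots m j = {t. ballot t \<and> length t = m \<and> count_list t 0 \<le> j}"

lemma finite_ballots: "finite (ballots m j)"
  by (rule finite_subset [OF _ finite_lists_length_eq [of "{0, 1}" m]])
    (auto simp: ballots_def ballot_def)

lemma ballots_eq_half:
  assumes "m div 2 \<le> j"
  shows "ballots m j = {t. ballot t \<and> length t = m}"
proof -
  have "count_list t 0 \<le> j" if "ballot t" "length t = m" for t
    using assms that ballot_count_le [of t] ballot_length [of t] by linarith
  then show ?thesis by (auto simp: ballots_def)
qed

lemma ballots_Suc:
  assumes "2 * Suc j \<le> Suc m"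
  shows "ballots (Suc m) (Suc j) = (#) 1 ` ballots m (Suc j) \<union> (#) 0 ` ballots m j" (is "?L = ?R")
proof
  show "?L \<subseteq> ?R"
  proof
    fix t assume t: "t \<in> ?L"
    then obtain x u where xu: "t = x # u" "length u = m"
      by (auto simp: ballots_def length_Suc_conv)
    with t ballot_hd [of x u] have "x = 0 \<or> x = 1" by (auto simp: ballots_def)
    with t xu show "t \<in> ?R"
      by (auto simp: ballots_def ballot_zero ballot_one [unfolded One_nat_def])
  qed
  \<comment> \<open>The assumption amounts to 2 * j + 1 \<le> m: at most j zeros leave at least m -
    j \<ge> j + 1 ones, so a 0 may always be prepended.\<close>
  have "count_list t 0 < count_list t 1" if "t \<in> ballots m j" for t
    using that assms ballot_length [of t] by (auto simp: ballots_def)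
  then show "?R \<subseteq> ?L"
    by (auto simp: ballots_def ballot_zero ballot_one [unfolded One_nat_def])
qed

lemma card_ballots: "2 * j \<le> m \<Longrightarrow> card (ballots m j) = m choose j"
proof (induction m arbitrary: j)
  case 0
  then have "ballots 0 j = {[]}" by (auto simp: ballots_def ballot_Nil)
  with 0 show ?case by simp
next
  case (Suc m)
  show ?case
  proof (cases j)
    case 0
    \<comment> \<open>With no zeros allowed, the branch of words starting with 0 is empty.\<close>
    have "ballots (Suc m) 0 = (#) 1 ` ballots m 0"
    proof (intro equalityI subsetI)
      fix t assume t: "t \<in> ballots (Suc m) 0"
      then obtain x u where xu: "t = x # u" by (cases t) (auto simp: ballots_def)
      with t ballot_hd [of x u] have "x = 1" by (auto simp: ballots_def split: if_splits)
      with t xu show "t \<in> (#) 1 ` ballots m 0"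
        by (auto simp: ballots_def ballot_one [unfolded One_nat_def])
    qed (auto simp: ballots_def ballot_one [unfolded One_nat_def])
    with 0 Suc.IH [of 0] show ?thesis by (simp add: card_image)
  next
    case (Suc i)
    have "card (ballots (Suc m) (Suc i)) = card (ballots m (Suc i)) + card (ballots m i)"
    proof -
      have "(#) (1::nat) ` ballots m (Suc i) \<inter> (#) 0 ` ballots m i = {}" by auto
      then show ?thesis
        using Suc.prems Suc
        by (simp add: ballots_Suc card_Un_disjoint finite_ballots card_image)
    qed
    moreover have "card (ballots m i) = m choose i"
      using Suc.IH Suc.prems Suc by simp
    moreover have "card (ballots m (Suc i)) = m choose Suc i"
    proof (cases "2 * Suc i \<le> m")
      case True
      then show ?thesis by (rule Suc.IH)
    next
      case False
      \<comment> \<open>Here \<open>Suc i\<close> exceeds m / 2, so the induction hypothesis does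
        not apply to it. But m div 2 = i, so both bounds admit every ballot word of length m, and m
        - i = i + 1 gives the symmetry.\<close>
      with Suc.prems Suc have m: "m = 2 * i + 1" by simp
      then have "ballots m (Suc i) = ballots m i"
        by (simp add: ballots_eq_half)
      moreover have "m choose i = m choose Suc i"
        using binomial_symmetric [of i m] m by simp
      ultimately show ?thesis
        using Suc.IH [of i] m by simp
    qed
    ultimately show ?thesis using Suc by simp
  qed
qed

lemma dyck_number_iff_ballot: "dyck_number d \<longleftrightarrow> d > 0 \<and> ballot (binary_digits d)"
  using set_binary_digits by (simp add: dyck_number_def ballot_def)

lemma binary_digits_image_dyck_numbers:
  "binary_digits ` dyck_numbers_of_length (Suc m) = (#) 1 ` {t. ballot t \<and> length t = m}"
proof (intro equalityI subsetI)
  fix w assume "w \<in> binary_digits ` dyck_numbers_of_length (Suc m)"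
  then obtain d where d: "w = binary_digits d" "d > 0" "ballot w" "length w = Suc m"
    by (auto simp: dyck_numbers_of_length_def dyck_number_iff_ballot)
  then have "w = 1 # tl w"
    using hd_binary_digits [of d] by (metis list.collapse)
  with d show "w \<in> (#) 1 ` {t. ballot t \<and> length t = m}"
    by (metis (mono_tags, lifting) ballot_one image_eqI length_Cons mem_Collect_eq nat.inject)
next
  fix w assume "w \<in> (#) 1 ` {t. ballot t \<and> length t = m}"
  then obtain t where t: "w = 1 # t" "ballot t" "length t = m" by auto
  \<comment> \<open>The witness is the number that the word denotes; \<open>rev\<close> is there
    because \<open>horner_sum\<close> takes the least significant digit first.\<close>
  let ?d = "horner_sum id 2 (rev (1 # t)) :: nat"
  have "?d > 0" "binary_digits ?d = w"
    using binary_digits_horner_sum [of t] t by (simp_all add: ballot_def)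
  moreover have "ballot w" using t ballot_one by simp
  ultimately have "?d \<in> dyck_numbers_of_length (Suc m)"
    using t by (simp add: dyck_numbers_of_length_def dyck_number_iff_ballot)
  with \<open>binary_digits ?d = w\<close> show "w \<in> binary_digits ` dyck_numbers_of_length (Suc m)"
    by blast
qed

theorem mainTheorem1:
  fixes n :: nat
  assumes "n \<ge> 1"
  shows "card (dyck_numbers_of_length n) = (n - 1) choose ((n - 1) div 2)"
proof -
  obtain m where n: "n = Suc m" using assms by (cases n) auto
  have "card (dyck_numbers_of_length n) = card (binary_digits ` dyck_numbers_of_length n)"
    by (metis card_image inj_binary_digits inj_on_subset subset_UNIV)
  also have "\<dots> = card {t. ballot t \<and> length t = m}"
    unfolding n binary_digits_image_dyck_numbers by (simp add: card_image)
  also have "\<dots> = card (ballots m (m div 2))"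
    by (simp add: ballots_eq_half)
  also have "\<dots> = m choose (m div 2)"
    by (rule card_ballots) simp
  finally show ?thesis using n by simp
qed

end
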